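(* Let $B$ be the ordinal sum of copulas $\{B_k\mid k=1,\ldots,n\}$ with respect to a finite family $\{(a_k,b_k)\mid k=1,\ldots,n\}$ of disjoint open subintervals of $[0,1]$. Then Spearman's footrule of $B$ is $$\phi(B)=1-\sum_{k=1}^n(b_k-a_k)^2(1-\phi(B_k)).$$
   Context: Let $\mathbb{I}=[0,1]$. A (bivariate) copula is a function $C:\mathbb{I}^2\to\mathbb{I}$ with $C(0,v)=C(u,0)=0$, $C(u,1)=u$, $C(1,v)=v$ for all $u,v\in\mathbb{I}$, and $C(u_2,v_2)-C(u_2,v_1)-C(u_1,v_2)+C(u_1,v_1)\ge 0$ whenever $u_1\le u_2$, $v_1\le v_2$ in $\mathbb{I}$. Given disjoint open subintervals $(a_k,b_k)$ of $\mathbb{I}$ and copulas $B_k$, $k=1,\ldots,n$, the ordinal sum $B$ of $\{B_k\}$ with respect to $\{(a_k,b_k)\}$ is the copula defined by $B(u,v)=a_k+(b_k-a_k)B_k\big(\frac{u-a_k}{b_k-a_k},\frac{v-a_k}{b_k-a_k}\big)$ if $(u,v)\in[a_k,b_k]^2$ for some $k$, and $B(u,v)=\min\{u,v\}$ otherwise. Spearman's footrule of a copula $C$ is $\phi(C)=6\int_0^1 C(u,u)\,du-2$. *)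

theory Defs
  imports "HOL-Analysis.Analysis"
begin

(* Functions on the unit square are total functions on the reals; their values outside
   the unit square are irrelevant. *)
definition is_copula :: "(real \<Rightarrow> real \<Rightarrow> real) \<Rightarrow> bool" where
  "is_copula C \<longleftrightarrow>
     (\<forall>u\<in>{0..1}. \<forall>v\<in>{0..1}. C u v \<in> {0..1}) \<and>
     (\<forall>v\<in>{0..1}. C 0 v = 0) \<and>
     (\<forall>u\<in>{0..1}. C u 0 = 0) \<and>
     (\<forall>u\<in>{0..1}. C u 1 = u) \<and>
     (\<forall>v\<in>{0..1}. C 1 v = v) \<and>
     (\<forall>u1\<in>{0..1}. \<forall>u2\<in>{0..1}. \<forall>v1\<in>{0..1}. \<forall>v2\<in>{0..1}. u1 \<le> u2 \<longrightarrow> v1 \<le> v2 \<longrightarrow>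
        C u2 v2 - C u2 v1 - C u1 v2 + C u1 v1 \<ge> 0)"

(* Two of the closed squares may share a corner; the LEAST operator only makes the definition
   unambiguous, and ordinal_sum_eq below shows that the choice of k does not matter. *)
definition ordinal_sum ::
  "nat \<Rightarrow> (nat \<Rightarrow> real) \<Rightarrow> (nat \<Rightarrow> real) \<Rightarrow> (nat \<Rightarrow> real \<Rightarrow> real \<Rightarrow> real) \<Rightarrow> real \<Rightarrow> real \<Rightarrow> real" where
  "ordinal_sum n a b Bs u v =
     (if \<exists>k\<in>{1..n}. u \<in> {a k..b k} \<and> v \<in> {a k..b k}
      then let k = (LEAST k. k \<in> {1..n} \<and> u \<in> {a k..b k} \<and> v \<in> {a k..b k})
           in a k + (b k - a k) * Bs k ((u - a k) / (b k - a k)) ((v - a k) / (b k - a k))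
      else min u v)"

definition footrule :: "(real \<Rightarrow> real \<Rightarrow> real) \<Rightarrow> real" where
  "footrule C = 6 * integral {0..1} (\<lambda>u. C u u) - 2"

lemma ordinal_sum_eq:
  assumes ab: "\<And>k. k \<in> {1..n} \<Longrightarrow> a k < b k"
    and disj: "disjoint_family_on (\<lambda>k. {a k<..<b k}) {1..n}"
    and cop: "\<And>k. k \<in> {1..n} \<Longrightarrow> is_copula (Bs k)"
    and k: "k \<in> {1..n}" "u \<in> {a k..b k}" "v \<in> {a k..b k}"
  shows "ordinal_sum n a b Bs u v =
           a k + (b k - a k) * Bs k ((u - a k) / (b k - a k)) ((v - a k) / (b k - a k))"
proof -
  define f where "f = (\<lambda>k. a k + (b k - a k) * Bs k ((u - a k) / (b k - a k)) ((v - a k) / (b k - a k)))"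
  define P where "P = (\<lambda>k. k \<in> {1..n} \<and> u \<in> {a k..b k} \<and> v \<in> {a k..b k})"
  have left: "f i = a i" if "i \<in> {1..n}" "u = a i" "v = a i" for i
    using that cop[OF that(1)] by (auto simp: f_def is_copula_def)
  have right: "f i = b i" if "i \<in> {1..n}" "u = b i" "v = b i" for i
    using that cop[OF that(1)] ab[OF that(1)] by (auto simp: f_def is_copula_def)
  have ends: "b i \<le> a j \<or> b j \<le> a i" if ij: "i \<in> {1..n}" "j \<in> {1..n}" "i \<noteq> j" for i j
  proof (rule ccontr)
    assume "\<not> ?thesis"
    then have "max (a i) (a j) < min (b i) (b j)"
      using ab ij by auto
    then obtain x where "max (a i) (a j) < x" "x < min (b i) (b j)"
      using dense by blast
    then have "x \<in> {a i<..<b i} \<inter> {a j<..<b j}" by auto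
    then show False using disjoint_family_onD[OF disj ij] by blast
  qed
  have same: "f i = f j" if "P i" "P j" for i j
  proof (cases "i = j")
    case False
    have ij: "i \<in> {1..n}" "j \<in> {1..n}" using that by (auto simp: P_def)
    from ends[OF ij False] show ?thesis
    proof
      assume "b i \<le> a j"
      then have "u = b i" "v = b i" "u = a j" "v = a j" using that by (auto simp: P_def)
      then show ?thesis using left[OF ij(2)] right[OF ij(1)] by simp
    next
      assume "b j \<le> a i"
      then have "u = b j" "v = b j" "u = a i" "v = a i" using that by (auto simp: P_def)
      then show ?thesis using left[OF ij(1)] right[OF ij(2)] by simp
    qed
  qed auto
  have Pk: "P k" using k by (simp add: P_def)
  then have PL: "P (LEAST k. P k)" by (rule LeastI)
  have "ordinal_sum n a b Bs u v = f (LEAST k. P k)"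
    using k by (auto simp: ordinal_sum_def f_def P_def Let_def)
  also have "\<dots> = f k" using same[OF PL Pk] .
  finally show ?thesis by (simp add: f_def)
qed

end

(* The defect u - B u u vanishes off the intervals and at their endpoints, and on the k-th interval
   it is the defect of B_k, rescaled by b_k - a_k in both the argument and the value. Integrating it
   therefore gives the sum of (b_k - a_k)^2 times the integrals of the defects of the B_k, and the
   integral of a defect is (1 - footrule) / 6. *)
theory Submission
  imports Defs
begin

text \<open>The rectangles [0,t] x [s,t] and [s,t] x [0,s] give
  \<open>C s s \<le> C t s \<le> C t t\<close>, because \<open>C\<close> vanishes when either
  argument is 0. Monotonicity is what makes the diagonal integrable.\<close>

lemma copula_diagonal_mono:
  assumes "is_copula C"
  shows "mono_on {0..1} (\<lambda>t. C t t)"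
proof (rule mono_onI)
  fix s t :: real
  assume st: "s \<in> {0..1}" "t \<in> {0..1}" "s \<le> t"
  have rect: "C u2 v2 - C u2 v1 - C u1 v2 + C u1 v1 \<ge> 0"
    if "u1 \<in> {0..1}" "u2 \<in> {0..1}" "v1 \<in> {0..1}" "v2 \<in> {0..1}" "u1 \<le> u2" "v1 \<le> v2"
    for u1 u2 v1 v2
    using assms that unfolding is_copula_def by blast
  have zero: "C 0 u = 0" "C u 0 = 0" if "u \<in> {0..1}" for u
    using assms that unfolding is_copula_def by blast+
  show "C s s \<le> C t t"
    using rect[of 0 t s t] rect[of s t 0 s] zero[OF st(1)] zero[OF st(2)] zero[of 0] st by auto
qed

lemma copula_defect_has_integral:
  assumes "is_copula C"
  shows "((\<lambda>t. t - C t t) has_integral (1 - footrule C) / 6) {0..1}"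
proof -
  have "(\<lambda>t. C t t) integrable_on {0..1}"
    using copula_diagonal_mono[OF assms] by (rule integrable_on_mono_on)
  then have "((\<lambda>t. C t t) has_integral integral {0..1} (\<lambda>t. C t t)) {0..1}"
    by (rule integrable_integral)
  moreover have "((\<lambda>t::real. t) has_integral 1 / 2) {0..1}"
    using ident_has_integral[of "0::real" 1] by simp
  ultimately have "((\<lambda>t. t - C t t) has_integral 1 / 2 - integral {0..1} (\<lambda>t. C t t)) {0..1}"
    by (intro has_integral_diff)
  moreover have "1 / 2 - integral {0..1} (\<lambda>t. C t t) = (1 - footrule C) / 6"
    by (simp add: footrule_def)
  ultimately show ?thesis
    by (simp only:)
qed

text \<open>The substitution \<open>t = (u - a) / (b - a)\<close> contributes one factor
  \<open>b - a\<close>; the factor in front of \<open>f\<close> contributes the other.\<close>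

lemma rescaled_defect_has_integral:
  fixes a b :: real
  assumes "(f has_integral i) {0..1}" "a < b"
  shows "((\<lambda>u. (b - a) * f ((u - a) / (b - a))) has_integral (b - a)\<^sup>2 * i) {a..b}"
proof -
  \<comment> \<open>The substitution is put in the form slope times \<open>u\<close> plus offset;
    the box is the preimage of [0,1], identified with \<open>{a..b}\<close> below.\<close>
  have "((\<lambda>u. f ((1 / (b - a)) *\<^sub>R u + (- a / (b - a)))) has_integral
      i /\<^sub>R (1 / (b - a)) ^ DIM(real))
    (cbox ((0 - (- a / (b - a))) /\<^sub>R (1 / (b - a))) ((1 - (- a / (b - a))) /\<^sub>R (1 / (b - a))))"
    using assms by (intro has_integral_affinity') auto
  moreover have "(1 / (b - a)) *\<^sub>R u + (- a / (b - a)) = (u - a) / (b - a)" for u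
    by (simp add: diff_divide_distrib)
  moreover have "(0 - (- a / (b - a))) /\<^sub>R (1 / (b - a)) = a"
      "(1 - (- a / (b - a))) /\<^sub>R (1 / (b - a)) = b"
    using assms(2) by (simp_all add: field_simps)
  ultimately have "((\<lambda>u. f ((u - a) / (b - a))) has_integral (b - a) * i) {a..b}"
    using assms(2) by simp
  from has_integral_mult_right[OF this, of "b - a"] show ?thesis
    by (simp add: power2_eq_square mult.assoc)
qed

theorem proposition3p3:
  fixes n :: nat
    and a b :: "nat \<Rightarrow> real"
    and Bs :: "nat \<Rightarrow> real \<Rightarrow> real \<Rightarrow> real"
  assumes "\<And>k. k \<in> {1..n} \<Longrightarrow> is_copula (Bs k)"
    and "\<And>k. k \<in> {1..n} \<Longrightarrow> 0 \<le> a k \<and> a k < b k \<and> b k \<le> 1"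
    and "disjoint_family_on (\<lambda>k. {a k<..<b k}) {1..n}"
  shows "footrule (ordinal_sum n a b Bs) =
           1 - (\<Sum>k=1..n. (b k - a k)\<^sup>2 * (1 - footrule (Bs k)))"
proof -
  define B where "B = ordinal_sum n a b Bs"
  define h where "h = (\<lambda>k u. (b k - a k) *
    ((u - a k) / (b k - a k) - Bs k ((u - a k) / (b k - a k)) ((u - a k) / (b k - a k))))"
  \<comment> \<open>Extending by zero turns the rescaled defects into functions on the whole line,
    which can be added pointwise.\<close>
  define H where "H = (\<lambda>k u. if u \<in> {a k..b k} then h k u else 0)"
  define S where "S = (\<Sum>k=1..n. (b k - a k)\<^sup>2 * (1 - footrule (Bs k)))"
  have formula: "u - B u u = h k u" if "k \<in> {1..n}" "u \<in> {a k..b k}" for k u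
  proof -
    have "B u u = a k + (b k - a k) * Bs k ((u - a k) / (b k - a k)) ((u - a k) / (b k - a k))"
      unfolding B_def by (rule ordinal_sum_eq) (use assms that in auto)
    moreover have "u - a k = (b k - a k) * ((u - a k) / (b k - a k))"
      using assms(2)[OF that(1)] by simp
    ultimately show ?thesis
      unfolding h_def right_diff_distrib[of "b k - a k"] by linarith
  qed
  \<comment> \<open>Closed intervals may share an endpoint, but there the rescaled argument is 0 or
    1, and \<open>Bs k 0 0 = 0\<close> and \<open>Bs k 1 1 = 1\<close> make the defect vanish. So
    each \<open>H k\<close> lives on an open interval, and these are disjoint.\<close>
  have endpoint: "H k u = 0" if "k \<in> {1..n}" "u \<notin> {a k<..<b k}" for k u
  proof (cases "u = a k \<or> u = b k")
    case True
    then show ?thesis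
      using assms(1,2)[OF that(1)] by (auto simp: H_def h_def is_copula_def)
  qed (use that in \<open>auto simp: H_def\<close>)
  \<comment> \<open>At most one summand is nonzero at each \<open>u\<close>. The identity holds for
    every real \<open>u\<close>, so it can be rewritten under the integral.\<close>
  have decomp: "u - B u u = (\<Sum>k=1..n. H k u)" for u
  proof (cases "\<exists>k\<in>{1..n}. u \<in> {a k<..<b k}")
    case True
    then obtain k where k: "k \<in> {1..n}" "u \<in> {a k<..<b k}" by blast
    have "H j u = 0" if "j \<in> {1..n} - {k}" for j
      using disjoint_family_onD[OF assms(3), of j k] that k by (intro endpoint) auto
    then have "(\<Sum>j=1..n. H j u) = (\<Sum>j\<in>{k}. H j u)"
      using k(1) by (intro sum.mono_neutral_right) auto
    also have "\<dots> = u - B u u"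
      using formula[of k u] k by (simp add: H_def)
    finally show ?thesis by simp
  next
    case False
    have "u - B u u = 0"
    \<comment> \<open>Either \<open>u\<close> is an endpoint of some interval, where the defect
      equals \<open>H k u = 0\<close>, or \<open>B u u = min u u = u\<close>.\<close>
    proof (cases "\<exists>k\<in>{1..n}. u \<in> {a k..b k}")
      case True
      then obtain k where "k \<in> {1..n}" "u \<in> {a k..b k}" by blast
      then show ?thesis
        using formula[of k u] endpoint[of k u] False by (auto simp: H_def)
    qed (auto simp: B_def ordinal_sum_def)
    then show ?thesis
      using endpoint False by simp
  qed
  have "(H k has_integral (b k - a k)\<^sup>2 * ((1 - footrule (Bs k)) / 6)) {0..1}"
    if "k \<in> {1..n}" for k
    unfolding H_def h_def
    using rescaled_defect_has_integral[OF copula_defect_has_integral[OF assms(1)[OF that]],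
        of "a k" "b k"] assms(2)[OF that]
    \<comment> \<open>The bounds \<open>0 \<le> a k\<close> and \<open>b k \<le> 1\<close> place the
      support of \<open>H k\<close> inside the unit interval.\<close>
    by (subst has_integral_restrict) auto
  then have "((\<lambda>u. u - B u u) has_integral
      (\<Sum>k=1..n. (b k - a k)\<^sup>2 * ((1 - footrule (Bs k)) / 6))) {0..1}"
    unfolding decomp by (intro has_integral_sum) auto
  also have "(\<Sum>k=1..n. (b k - a k)\<^sup>2 * ((1 - footrule (Bs k)) / 6)) = S / 6"
    by (simp add: S_def sum_divide_distrib)
  \<comment> \<open>The diagonal of \<open>B\<close> is recovered as the identity minus its defect,
    so its integral comes from the two integrals already known.\<close>
  finally have "((\<lambda>u. u - (u - B u u)) has_integral 1 / 2 - S / 6) {0..1}"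
    using ident_has_integral[of "0::real" 1] by (intro has_integral_diff) auto
  then have "integral {0..1} (\<lambda>u. B u u) = 1 / 2 - S / 6"
    by (simp add: integral_unique)
  then show ?thesis
    by (simp add: footrule_def B_def S_def)
qed

end
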